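(* Let $G$ be a bridgeless outerplanar graph of order $n$ with diameter $2$. Then $rc(G)\leq 3$; that is, $rc(G)\in\{2,3\}$.
   Context: All graphs are simple, finite and undirected. A graph is outerplanar if it can be embedded in the plane so that all vertices lie on a common face. An edge-colored graph is rainbow connected if every two vertices are joined by a path whose edges have pairwise distinct colors. The rainbow connection number $rc(G)$ of a connected graph $G$ is the smallest number of colors in an edge-coloring of $G$ that makes $G$ rainbow connected. *)

theory Defs
  imports "HOL-Analysis.Analysis"
begin

definition simple_graph :: "'a set \<Rightarrow> ('a \<Rightarrow> 'a \<Rightarrow> bool) \<Rightarrow> bool" where
  "simple_graph V E \<longleftrightarrow> finite V \<and> (\<forall>u v. E u v \<longrightarrow> u \<in> V \<and> v \<in> V)
     \<and> (\<forall>u v. E u v \<longrightarrow> E v u) \<and> (\<forall>u. \<not> E u u)"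

definition walk :: "'a set \<Rightarrow> ('a \<Rightarrow> 'a \<Rightarrow> bool) \<Rightarrow> 'a list \<Rightarrow> 'a \<Rightarrow> 'a \<Rightarrow> bool" where
  "walk V E vs x y \<longleftrightarrow> vs \<noteq> [] \<and> hd vs = x \<and> last vs = y \<and> set vs \<subseteq> V
     \<and> (\<forall>i. Suc i < length vs \<longrightarrow> E (vs ! i) (vs ! Suc i))"

definition gpath :: "'a set \<Rightarrow> ('a \<Rightarrow> 'a \<Rightarrow> bool) \<Rightarrow> 'a list \<Rightarrow> 'a \<Rightarrow> 'a \<Rightarrow> bool" where
  "gpath V E vs x y \<longleftrightarrow> walk V E vs x y \<and> distinct vs"

definition connected_graph :: "'a set \<Rightarrow> ('a \<Rightarrow> 'a \<Rightarrow> bool) \<Rightarrow> bool" where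
  "connected_graph V E \<longleftrightarrow> V \<noteq> {} \<and> (\<forall>x\<in>V. \<forall>y\<in>V. \<exists>vs. walk V E vs x y)"

definition gdist :: "'a set \<Rightarrow> ('a \<Rightarrow> 'a \<Rightarrow> bool) \<Rightarrow> 'a \<Rightarrow> 'a \<Rightarrow> nat" where
  "gdist V E x y = (LEAST n. \<exists>vs. walk V E vs x y \<and> length vs = Suc n)"

definition graph_diameter :: "'a set \<Rightarrow> ('a \<Rightarrow> 'a \<Rightarrow> bool) \<Rightarrow> nat" where
  "graph_diameter V E = Max {gdist V E x y | x y. x \<in> V \<and> y \<in> V}"

definition del_edge :: "('a \<Rightarrow> 'a \<Rightarrow> bool) \<Rightarrow> 'a \<Rightarrow> 'a \<Rightarrow> ('a \<Rightarrow> 'a \<Rightarrow> bool)" where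
  "del_edge E u v = (\<lambda>a b. E a b \<and> {a, b} \<noteq> {u, v})"

definition is_bridge :: "'a set \<Rightarrow> ('a \<Rightarrow> 'a \<Rightarrow> bool) \<Rightarrow> 'a \<Rightarrow> 'a \<Rightarrow> bool" where
  "is_bridge V E u v \<longleftrightarrow> E u v \<and> \<not> (\<exists>vs. walk V (del_edge E u v) vs u v)"

definition bridgeless :: "'a set \<Rightarrow> ('a \<Rightarrow> 'a \<Rightarrow> bool) \<Rightarrow> bool" where
  "bridgeless V E \<longleftrightarrow> (\<forall>u v. \<not> is_bridge V E u v)"

text \<open>Outerplanarity: a plane embedding (vertices as distinct points of the plane,
edges as arcs meeting the vertex set only in their endpoints and meeting each other
only in common endpoints) such that all vertices lie on (the closure of) one common
face, i.e. one connected component of the complement of the drawing.\<close>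

definition outerplanar :: "'a set \<Rightarrow> ('a \<Rightarrow> 'a \<Rightarrow> bool) \<Rightarrow> bool" where
  "outerplanar V E \<longleftrightarrow>
    (\<exists>(pos :: 'a \<Rightarrow> complex) (\<gamma> :: 'a \<Rightarrow> 'a \<Rightarrow> real \<Rightarrow> complex).
       inj_on pos V
     \<and> (\<forall>u v. E u v \<longrightarrow> arc (\<gamma> u v) \<and> pathstart (\<gamma> u v) = pos u \<and> pathfinish (\<gamma> u v) = pos v
           \<and> path_image (\<gamma> u v) = path_image (\<gamma> v u)
           \<and> path_image (\<gamma> u v) \<inter> pos ` V = {pos u, pos v})
     \<and> (\<forall>u v x y. E u v \<longrightarrow> E x y \<longrightarrow> {u, v} \<noteq> {x, y} \<longrightarrow>
           path_image (\<gamma> u v) \<inter> path_image (\<gamma> x y) \<subseteq> pos ` ({u, v} \<inter> {x, y}))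
     \<and> (\<exists>F \<in> components (- (pos ` V \<union> (\<Union>{path_image (\<gamma> u v) | u v. E u v}))).
           pos ` V \<subseteq> closure F))"

definition edge_colouring :: "('a \<Rightarrow> 'a \<Rightarrow> bool) \<Rightarrow> nat \<Rightarrow> ('a \<Rightarrow> 'a \<Rightarrow> nat) \<Rightarrow> bool" where
  "edge_colouring E k c \<longleftrightarrow> (\<forall>u v. E u v \<longrightarrow> c u v = c v u \<and> c u v < k)"

definition rainbow_connected :: "'a set \<Rightarrow> ('a \<Rightarrow> 'a \<Rightarrow> bool) \<Rightarrow> ('a \<Rightarrow> 'a \<Rightarrow> nat) \<Rightarrow> bool" where
  "rainbow_connected V E c \<longleftrightarrow>
    (\<forall>x\<in>V. \<forall>y\<in>V. x \<noteq> y \<longrightarrow>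
       (\<exists>vs. gpath V E vs x y \<and> distinct (map (\<lambda>(a, b). c a b) (zip vs (tl vs)))))"

definition rc :: "'a set \<Rightarrow> ('a \<Rightarrow> 'a \<Rightarrow> bool) \<Rightarrow> nat" where
  "rc V E = (LEAST k. \<exists>c. edge_colouring E k c \<and> rainbow_connected V E c)"

end

theory Submission
  imports Defs
begin

text \<open>
If all points of a theta curve's three open arcs could be seen from one face, Janiszewski's
theorem would join the two sides of the cycle formed by two of the arcs. Hence an outerplanar
graph has no two vertices joined by three internally disjoint paths with inner vertices (no
subdivision of \<open>K\<^sub>2\<^sub>,\<^sub>3\<close>), and this is the only consequence of outerplanarity that is used.

If some vertex \<open>v\<close> is adjacent to all others, take a maximal independent set of \<open>G - v\<close>; it
splits \<open>G - v\<close> into two classes such that every vertex has a neighbour in the other class. Give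
the edges at \<open>v\<close> one colour per class and all other edges the third colour.

Otherwise diameter 2 forces a longest cycle to be Hamiltonian, since a vertex off the cycle yields
an ear that either lengthens the cycle or creates a theta. Chords do not cross. If a chord \<open>ab\<close> had
at least two vertices on each side, the vertices on the two sides would have common neighbours
only among \<open>a\<close> and \<open>b\<close>, making \<open>a\<close> or \<open>b\<close> universal or creating a theta; so every chord cuts off
a single vertex. With diameter 2 this is possible only for cycles of length at most 6, and there
colouring the cycle periodically with three colours suffices.
\<close>

section \<open>Theta curves in the plane\<close>

text \<open>By the Jordan curve theorem the closed curve formed by \<open>c\<close> and
  \<open>d\<close> has two sides. The connected set \<open>F\<close> lies in one of them,
  \<open>A\<close>; the other is \<open>B\<close>. The open set \<open>B\<close> misses
  \<open>F\<close> and hence \<open>closure F\<close>, so \<open>p\<close> lies in \<open>A\<close>,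
  and the connected open arc of \<open>e\<close> follows it. The formula for
  \<open>closure B\<close> holds because the whole curve is the frontier of each side.\<close>

lemma theta_side:
  fixes c d e :: "real \<Rightarrow> complex"
  assumes arcs: "arc c" "arc d" "arc e"
    and starts: "pathstart c = a" "pathstart d = a" "pathstart e = a"
    and ends: "pathfinish c = b" "pathfinish d = b" "pathfinish e = b"
    and int: "path_image c \<inter> path_image d \<subseteq> {a, b}"
      "path_image c \<inter> path_image e \<subseteq> {a, b}" "path_image d \<inter> path_image e \<subseteq> {a, b}"
    and p: "p \<in> path_image e - {a, b}" "p \<in> closure F"
    and F: "connected F" "F \<inter> (path_image c \<union> path_image d) = {}"
  obtains A B where "open A" "connected A" "open B" "connected B" "A \<inter> B = {}" "B \<noteq> {}"
    "A \<union> B = - (path_image c \<union> path_image d)"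
    "closure B = B \<union> path_image c \<union> path_image d"
    "F \<subseteq> A" "p \<in> A" "path_image e \<inter> B = {}"
proof -
  define S where "S = path_image c \<union> path_image d"
  define l where "l = c +++ reversepath d"
  have sl: "simple_path l"
    unfolding l_def by (rule simple_path_join_loop) (use arcs starts ends int in \<open>auto simp: arc_reversepath\<close>)
  have cl: "pathfinish l = pathstart l" unfolding l_def using starts by simp
  have iml: "path_image l = S"
    unfolding l_def S_def using starts ends by (simp add: path_image_join)
  note J = Jordan_inside_outside[OF sl cl, unfolded iml]
  have Fne: "F \<noteq> {}" using p by auto
  \<comment> \<open>Whether \<open>F\<close> is inside or outside the curve is unknown; naming the
    sides by their position relative to \<open>F\<close> confines this case distinction to this
    step.\<close>
  have "\<exists>A B. open A \<and> connected A \<and> open B \<and> connected B \<and> A \<inter> B = {} \<and> B \<noteq> {} \<and>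
      A \<union> B = - S \<and> frontier B = S \<and> F \<subseteq> A"
  proof -
    have un: "F \<subseteq> inside S \<union> outside S" using F J by (auto simp: S_def)
    have dj: "inside S \<inter> outside S \<inter> F = {}" using J by auto
    have opi: "open (inside S)" "open (outside S)" using J by auto
    have "inside S \<inter> F = {} \<or> outside S \<inter> F = {}"
      using connectedD[OF F(1) opi dj un] by blast
    then consider "F \<subseteq> inside S" | "F \<subseteq> outside S" using un by blast
    then show ?thesis
    proof cases
      case 1
      show ?thesis by (intro exI[of _ "inside S"] exI[of _ "outside S"]) (use J 1 in auto)
    next
      case 2
      show ?thesis by (intro exI[of _ "outside S"] exI[of _ "inside S"]) (use J 2 in \<open>simp_all add: Int_commute Un_commute\<close>)
    qed
  qed
  then obtain A B where AB: "open A" "connected A" "open B" "connected B" "A \<inter> B = {}" "B \<noteq> {}"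
      "A \<union> B = - S" "frontier B = S" "F \<subseteq> A" by blast
  have clB: "closure B = B \<union> S"
    using AB closure_Un_frontier by blast
  have pA: "p \<in> A"
  proof -
    have "p \<notin> S" using p int unfolding S_def by blast
    moreover have "p \<notin> B"
    proof
      assume "p \<in> B"
      then have "B \<inter> F \<noteq> {}" using p(2) open_Int_closure_eq_empty[OF AB(3), of F] by blast
      then show False using AB(5,9) by blast
    qed
    ultimately show ?thesis using AB(7) by blast
  qed
  have "path_image e \<inter> B = {}"
  proof -
    let ?E = "path_image e - {a, b}"
    have con: "connected ?E" using connected_simple_path_endless[of e] arcs(3) starts ends
      by (simp add: arc_imp_simple_path)
    have "?E \<subseteq> A \<union> B" using AB(7) int unfolding S_def by blast
    then have "A \<inter> ?E = {} \<or> B \<inter> ?E = {}"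
      using connectedD[OF con AB(1,3)] AB(5) by blast
    then have "B \<inter> ?E = {}" using pA p by blast
    moreover have "a \<in> S" "b \<in> S"
      unfolding S_def using starts ends pathstart_in_path_image pathfinish_in_path_image by blast+
    ultimately show ?thesis using AB(7) by blast
  qed
  then show ?thesis using that[of A B] AB clB pA unfolding S_def by (simp add: Un_assoc)
qed

text \<open>Let \<open>B\<close> be the side of the curve of \<open>c\<close> and \<open>d\<close>
  that avoids \<open>F\<close>. It also avoids \<open>e\<close>, and it can be joined to
  \<open>F\<close> off \<open>c\<close> and \<open>e\<close>, as well as off \<open>d\<close> and
  \<open>e\<close>. Janiszewski's theorem then joins \<open>B\<close> to \<open>F\<close> off all
  three arcs, although \<open>c\<close> and \<open>d\<close> alone already separate them.\<close>

lemma no_theta_curve: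
  fixes c d e :: "real \<Rightarrow> complex"
  assumes arcs: "arc c" "arc d" "arc e"
    and starts: "pathstart c = a" "pathstart d = a" "pathstart e = a"
    and ends: "pathfinish c = b" "pathfinish d = b" "pathfinish e = b"
    and int: "path_image c \<inter> path_image d \<subseteq> {a, b}"
      "path_image c \<inter> path_image e \<subseteq> {a, b}" "path_image d \<inter> path_image e \<subseteq> {a, b}"
    and p: "p \<in> path_image c - {a, b}" "q \<in> path_image d - {a, b}" "r \<in> path_image e - {a, b}"
    and cl: "{p, q, r} \<subseteq> closure F"
    and F: "connected F" "F \<inter> (path_image c \<union> path_image d \<union> path_image e) = {}"
  shows False
proof -
  let ?c = "path_image c" and ?d = "path_image d" and ?e = "path_image e"
  obtain A B where 1: "open A" "connected A" "open B" "connected B" "A \<inter> B = {}" "B \<noteq> {}"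
    "A \<union> B = - (?c \<union> ?d)" "closure B = B \<union> ?c \<union> ?d" "F \<subseteq> A" "r \<in> A" "?e \<inter> B = {}"
    by (rule theta_side[of c d e a b r F]) (use assms in auto)
  obtain A' B' where 2: "open A'" "connected A'" "open B'" "connected B'" "A' \<inter> B' = {}"
    "A' \<union> B' = - (?c \<union> ?e)" "closure B' = B' \<union> ?c \<union> ?e" "F \<subseteq> A'" "q \<in> A'"
    by (rule theta_side[of c e d a b q F]) (use assms in auto)
  obtain A'' B'' where 3: "open A''" "connected A''" "open B''" "connected B''" "A'' \<inter> B'' = {}"
    "A'' \<union> B'' = - (?d \<union> ?e)" "closure B'' = B'' \<union> ?d \<union> ?e" "F \<subseteq> A''" "p \<in> A''"
    by (rule theta_side[of d e c a b p F]) (use assms in auto)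
  \<comment> \<open>Being connected, \<open>B\<close> lies in \<open>A'\<close> or in
    \<open>B'\<close>. Its closure contains \<open>q\<close>, a point of the open set
    \<open>A'\<close> outside \<open>closure B'\<close>, so it must be \<open>A'\<close>, the side
    of \<open>F\<close>.\<close>
  have inA': "B \<subseteq> A'"
  proof -
    have "B \<subseteq> A' \<union> B'" using 1(7,11) 2(6) by blast
    then have "A' \<inter> B = {} \<or> B' \<inter> B = {}"
      using connectedD[OF 1(4) 2(1,3)] 2(5) by blast
    moreover have "\<not> B \<subseteq> B'"
    proof
      assume "B \<subseteq> B'"
      then have "closure B \<subseteq> closure B'" by (rule closure_mono)
      then have "q \<in> closure B'" using p(2) 1(8) by blast
      then show False using 2(5,6,7,9) p(2) by blast
    qed
    ultimately show ?thesis using \<open>B \<subseteq> A' \<union> B'\<close> by blast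
  qed
  have inA'': "B \<subseteq> A''"
  proof -
    have "B \<subseteq> A'' \<union> B''" using 1(7,11) 3(6) by blast
    then have "A'' \<inter> B = {} \<or> B'' \<inter> B = {}"
      using connectedD[OF 1(4) 3(1,3)] 3(5) by blast
    moreover have "\<not> B \<subseteq> B''"
    proof
      assume "B \<subseteq> B''"
      then have "closure B \<subseteq> closure B''" by (rule closure_mono)
      then have "p \<in> closure B''" using p(1) 1(8) by blast
      then show False using 3(5,6,7,9) p(1) by blast
    qed
    ultimately show ?thesis using \<open>B \<subseteq> A'' \<union> B''\<close> by blast
  qed
  obtain y where y: "y \<in> B" using 1(6) by blast
  obtain x where x: "x \<in> F" using cl by (metis closure_empty empty_iff equals0I insert_subset)
  have comp: "compact ?c" "compact ?d" "compact ?e"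
    using arcs by (auto intro: compact_arc_image)
  \<comment> \<open>Janiszewski's theorem needs a connected intersection; here it is the arc
    \<open>e\<close>, since \<open>c\<close> and \<open>d\<close> meet only in its
    endpoints.\<close>
  have meet: "(?c \<union> ?e) \<inter> (?d \<union> ?e) = ?e"
    using int starts(3) ends(3) pathstart_in_path_image[of e] pathfinish_in_path_image[of e] by blast
  have "connected_component (- ((?c \<union> ?e) \<union> (?d \<union> ?e))) x y"
  proof (rule Janiszewski)
    show "compact (?c \<union> ?e)" "closed (?d \<union> ?e)"
      using comp by (auto intro: compact_imp_closed)
    show "connected ((?c \<union> ?e) \<inter> (?d \<union> ?e))"
      unfolding meet using arcs by (simp add: connected_arc_image)
    show "connected_component (- (?c \<union> ?e)) x y"
      unfolding connected_component_def using 2(2,6,8) inA' x y by (intro exI[of _ A']) blast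
    show "connected_component (- (?d \<union> ?e)) x y"
      unfolding connected_component_def using 3(2,6,8) inA'' x y by (intro exI[of _ A'']) blast
  qed
  then obtain T where T: "connected T" "T \<subseteq> - (?c \<union> ?e \<union> (?d \<union> ?e))" "x \<in> T" "y \<in> T"
    unfolding connected_component_def by blast
  have "A \<inter> T = {} \<or> B \<inter> T = {}"
    by (rule connectedD[OF T(1) 1(1,3)]) (use 1(5,7) T(2) in blast)+
  then show False using T(3,4) x y 1(9) by blast
qed

section \<open>Thetas in graphs\<close>

text \<open>Forbids subdivisions of K_{2,3} with branch vertices \<open>x\<close> and
  \<open>y\<close>. All three lists must be nonempty because an inner vertex supplies the point of
  each open arc that lies in the closure of the common face; a bare edge \<open>x y\<close> has
  none.\<close>

definition theta_free :: "('a \<Rightarrow> 'a \<Rightarrow> bool) \<Rightarrow> bool" where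
  "theta_free E \<longleftrightarrow> (\<forall>x y ps qs rs. ps \<noteq> [] \<longrightarrow> qs \<noteq> [] \<longrightarrow> rs \<noteq> [] \<longrightarrow>
     distinct (x # y # ps @ qs @ rs) \<longrightarrow> successively E (x # ps @ [y]) \<longrightarrow>
     successively E (x # qs @ [y]) \<longrightarrow> \<not> successively E (x # rs @ [y]))"

lemma successively_zipD:
  assumes "successively E vs" "(u, v) \<in> set (zip vs (tl vs))"
  shows "E u v"
  using assms by (induction vs rule: induct_list012) auto

text \<open>Serves to tell apart the edges of two internally disjoint paths: each edge has an
  endpoint that the other path does not visit.\<close>

lemma inner_vertex_zip:
  assumes "(u, v) \<in> set (zip (x # ps @ [y]) (ps @ [y]))" "ps \<noteq> []"
  shows "u \<in> set ps \<or> v \<in> set ps"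
  using assms
proof (induction ps arbitrary: x)
  case (Cons p ps)
  then show ?case by (cases ps) auto
qed simp

lemma zip_tlD:
  assumes "(u, v) \<in> set (zip vs (tl vs))"
  shows "u \<in> set vs" "v \<in> set vs"
  using assms set_zip_leftD[of u v vs "tl vs"] set_zip_rightD[of u v vs "tl vs"]
  by (auto dest: list.set_sel(2)[rotated])

definition drawing :: "('a \<Rightarrow> 'a \<Rightarrow> real \<Rightarrow> complex) \<Rightarrow> 'a list \<Rightarrow> complex set" where
  "drawing \<gamma> vs = (\<Union>(u, v)\<in>set (zip vs (tl vs)). path_image (\<gamma> u v))"

text \<open>Induction along the path: since \<open>x\<close> does not recur, the arc of the first
  edge meets the later ones at most in \<open>pos y\<close>, so the arcs can be joined.\<close>

lemma drawing_arc:
  assumes "distinct vs" "successively E vs" "length vs \<ge> 2"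
    and \<gamma>: "\<And>u v. E u v \<Longrightarrow> arc (\<gamma> u v) \<and> pathstart (\<gamma> u v) = pos u \<and> pathfinish (\<gamma> u v) = pos v"
    and cross: "\<And>u v x y. E u v \<Longrightarrow> E x y \<Longrightarrow> {u, v} \<noteq> {x, y} \<Longrightarrow>
           path_image (\<gamma> u v) \<inter> path_image (\<gamma> x y) \<subseteq> pos ` ({u, v} \<inter> {x, y})"
  shows "\<exists>g. arc g \<and> pathstart g = pos (hd vs) \<and> pathfinish g = pos (last vs) \<and> path_image g = drawing \<gamma> vs"
  using assms(1-3)
proof (induction vs rule: induct_list012)
  case (3 x y zs)
  show ?case
  proof (cases zs)
    case Nil
    then show ?thesis using 3 \<gamma>[of x y] by (intro exI[of _ "\<gamma> x y"]) (auto simp: drawing_def)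
  next
    case (Cons z zs')
    then obtain g where g: "arc g" "pathstart g = pos y" "pathfinish g = pos (last (y # zs))"
        "path_image g = drawing \<gamma> (y # zs)"
      using 3 by auto
    have E: "E x y" using 3 by simp
    have "path_image (\<gamma> x y) \<inter> path_image (\<gamma> u v) \<subseteq> {pos y}"
      if uv: "(u, v) \<in> set (zip (y # zs) zs)" for u v
    proof -
      have "E u v" using successively_zipD[of E "y # zs" u v] 3 uv by simp
      moreover have "x \<notin> {u, v}" using zip_tlD[of u v "y # zs"] uv 3 by auto
      ultimately show ?thesis using cross[OF E, of u v] by blast
    qed
    then have "path_image (\<gamma> x y) \<inter> path_image g \<subseteq> {pos y}"
      unfolding g drawing_def by auto
    then have "arc (\<gamma> x y +++ g)" using \<gamma>[OF E] g by (intro arc_join) auto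
    moreover have "path_image (\<gamma> x y +++ g) = drawing \<gamma> (x # y # zs)"
      using \<gamma>[OF E] g by (simp add: path_image_join drawing_def)
    ultimately show ?thesis using \<gamma>[OF E] g by (intro exI[of _ "\<gamma> x y +++ g"]) auto
  qed
qed auto

text \<open>The three paths of a theta are drawn as three arcs with common ends. The inner vertices
  lie in the closure of the outer face \<open>F\<close>, so \<open>no_theta_curve\<close>
  applies.\<close>

lemma outerplanar_theta_free:
  assumes simple: "simple_graph V E" and outer: "outerplanar V E"
  shows "theta_free E"
  unfolding theta_free_def
proof (intro allI impI notI)
  fix x y ps qs rs
  assume ne: "ps \<noteq> []" "qs \<noteq> []" "rs \<noteq> []" and dist: "distinct (x # y # ps @ qs @ rs)"
    and suc: "successively E (x # ps @ [y])" "successively E (x # qs @ [y])" "successively E (x # rs @ [y])"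
  obtain pos :: "'a \<Rightarrow> complex" and \<gamma> where O: "inj_on pos V"
      "\<forall>u v. E u v \<longrightarrow> arc (\<gamma> u v) \<and> pathstart (\<gamma> u v) = pos u \<and> pathfinish (\<gamma> u v) = pos v
         \<and> path_image (\<gamma> u v) = path_image (\<gamma> v u)
         \<and> path_image (\<gamma> u v) \<inter> pos ` V = {pos u, pos v}"
      "\<forall>u v x y. E u v \<longrightarrow> E x y \<longrightarrow> {u, v} \<noteq> {x, y} \<longrightarrow>
         path_image (\<gamma> u v) \<inter> path_image (\<gamma> x y) \<subseteq> pos ` ({u, v} \<inter> {x, y})"
      "\<exists>F \<in> components (- (pos ` V \<union> (\<Union>{path_image (\<gamma> u v) | u v. E u v}))). pos ` V \<subseteq> closure F"
    using outer unfolding outerplanar_def by (elim exE conjE)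
  note inj = O(1)
  have \<gamma>: "arc (\<gamma> u v) \<and> pathstart (\<gamma> u v) = pos u \<and> pathfinish (\<gamma> u v) = pos v" if "E u v" for u v
    using O(2) that by blast
  have cross: "path_image (\<gamma> u v) \<inter> path_image (\<gamma> x y) \<subseteq> pos ` ({u, v} \<inter> {x, y})"
    if "E u v" "E x y" "{u, v} \<noteq> {x, y}" for u v x y
    using O(3) that by presburger
  obtain F where F: "F \<in> components (- (pos ` V \<union> (\<Union>{path_image (\<gamma> u v) | u v. E u v})))"
     and clF: "pos ` V \<subseteq> closure F"
    using O(4) by (elim bexE)
  have V: "u \<in> V \<and> v \<in> V" if "E u v" for u v using that simple unfolding simple_graph_def by blast
  let ?P = "\<lambda>ps. ps \<noteq> [] \<and> distinct (x # ps @ [y]) \<and> successively E (x # ps @ [y])"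
  let ?D = "\<lambda>ps. drawing \<gamma> (x # ps @ [y])"
  have P: "?P ps" "?P qs" "?P rs" using ne dist suc by auto
  have arc: "\<exists>g. arc g \<and> pathstart g = pos x \<and> pathfinish g = pos y \<and> path_image g = ?D ps" if "?P ps" for ps
    using drawing_arc[of "x # ps @ [y]" E \<gamma> pos] that \<gamma> cross by auto
  have sub: "?D ps \<subseteq> \<Union>{path_image (\<gamma> u v) | u v. E u v}" if "?P ps" for ps
    unfolding drawing_def using that successively_zipD[of E "x # ps @ [y]"] by fastforce
  \<comment> \<open>A common point lies on an edge of each path. These edges differ, each having an
    inner vertex of its own path, so the point is the image of a shared vertex, and only
    \<open>x\<close> and \<open>y\<close> can be shared.\<close>
  have meet: "?D ps \<inter> ?D qs \<subseteq> {pos x, pos y}" if "?P ps" "?P qs" "set ps \<inter> set qs = {}" for ps qs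
  proof
    fix z assume "z \<in> ?D ps \<inter> ?D qs"
    then obtain a b c d where ab: "(a, b) \<in> set (zip (x # ps @ [y]) (ps @ [y]))" "z \<in> path_image (\<gamma> a b)"
      and cd: "(c, d) \<in> set (zip (x # qs @ [y]) (qs @ [y]))" "z \<in> path_image (\<gamma> c d)"
      unfolding drawing_def by auto
    have E: "E a b" "E c d"
      using successively_zipD[of E "x # ps @ [y]" a b] successively_zipD[of E "x # qs @ [y]" c d] ab cd that
      by simp_all
    have in1: "a \<in> set ps \<or> b \<in> set ps" "{a, b} \<subseteq> {x, y} \<union> set ps"
      using inner_vertex_zip[OF ab(1)] zip_tlD[of a b "x # ps @ [y]"] ab that by auto
    have in2: "c \<in> set qs \<or> d \<in> set qs" "{c, d} \<subseteq> {x, y} \<union> set qs"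
      using inner_vertex_zip[OF cd(1)] zip_tlD[of c d "x # qs @ [y]"] cd that by auto
    have dj: "x \<notin> set ps" "y \<notin> set ps" "x \<notin> set qs" "y \<notin> set qs" using that by auto
    have "{a, b} \<noteq> {c, d}"
      using in1 in2 that(3) dj by (metis Un_iff disjoint_iff insert_iff singletonD subsetD insertI1)
    then have "z \<in> pos ` ({a, b} \<inter> {c, d})" using cross[OF E] ab cd by blast
    moreover have "{a, b} \<inter> {c, d} \<subseteq> {x, y}" using in1 in2 that(3) by blast
    ultimately show "z \<in> {pos x, pos y}" by blast
  qed
  have inner: "pos (hd ps) \<in> ?D ps - {pos x, pos y} \<and> pos (hd ps) \<in> closure F" if P: "?P ps" for ps
  proof -
    obtain p ps' where ps: "ps = p # ps'" using P by (cases ps) auto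
    have E: "E x p" using that ps by simp
    have "y \<in> V"
    proof -
      have "E (last ps) y" using that by (auto simp: successively_append_iff successively_Cons)
      then show ?thesis using V by blast
    qed
    then have "pos p \<noteq> pos x" "pos p \<noteq> pos y"
      using inj V[OF E] that ps unfolding inj_on_def by auto
    moreover have "pos p \<in> path_image (\<gamma> x p)" using \<gamma>[OF E] pathfinish_in_path_image by metis
    ultimately show ?thesis using ps V[OF E] clF unfolding drawing_def by auto
  qed
  obtain c d e where c: "arc c \<and> pathstart c = pos x \<and> pathfinish c = pos y \<and> path_image c = ?D ps"
      and d: "arc d \<and> pathstart d = pos x \<and> pathfinish d = pos y \<and> path_image d = ?D qs"
      and e: "arc e \<and> pathstart e = pos x \<and> pathfinish e = pos y \<and> path_image e = ?D rs"
    using arc[OF P(1)] arc[OF P(2)] arc[OF P(3)] by (elim exE)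
  have dj: "set ps \<inter> set qs = {}" "set ps \<inter> set rs = {}" "set qs \<inter> set rs = {}" using dist by auto
  have FD: "F \<inter> (?D ps \<union> ?D qs \<union> ?D rs) = {}"
  proof -
    have "F \<inter> \<Union>{path_image (\<gamma> u v) | u v. E u v} = {}"
      using in_components_subset[OF F] by (simp add: subset_Compl_self_eq disjoint_eq_subset_Compl)
    moreover have "F \<inter> (?D ps \<union> ?D qs \<union> ?D rs) \<subseteq> F \<inter> \<Union>{path_image (\<gamma> u v) | u v. E u v}"
      using sub[OF P(1)] sub[OF P(2)] sub[OF P(3)] by (intro Int_mono order_refl Un_least)
    ultimately show ?thesis by (simp only: subset_empty)
  qed
  show False
  proof (rule no_theta_curve[of c d e "pos x" "pos y" "pos (hd ps)" "pos (hd qs)" "pos (hd rs)" F])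
    show "path_image c \<inter> path_image d \<subseteq> {pos x, pos y}" using c d meet[OF P(1,2) dj(1)] by simp
    show "path_image c \<inter> path_image e \<subseteq> {pos x, pos y}" using c e meet[OF P(1,3) dj(2)] by simp
    show "path_image d \<inter> path_image e \<subseteq> {pos x, pos y}" using d e meet[OF P(2,3) dj(3)] by simp
    show "F \<inter> (path_image c \<union> path_image d \<union> path_image e) = {}" using c d e FD by simp
    show "connected F" using F in_components_connected by blast
  qed (use c d e inner[OF P(1)] inner[OF P(2)] inner[OF P(3)] in auto)
qed

lemma theta_freeD:
  assumes "theta_free E" "ps \<noteq> []" "qs \<noteq> []" "rs \<noteq> []" "distinct (x # y # ps @ qs @ rs)"
    "successively E (x # ps @ [y])" "successively E (x # qs @ [y])" "successively E (x # rs @ [y])"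
  shows False
  using assms unfolding theta_free_def by blast

lemma walk_iff_successively:
  "walk V E vs x y \<longleftrightarrow> vs \<noteq> [] \<and> hd vs = x \<and> last vs = y \<and> set vs \<subseteq> V \<and> successively E vs"
  unfolding walk_def successively_conv_nth ..

lemma successively_cut:
  assumes "successively E (us @ z # ws)"
  shows "successively E (us @ [z])" "successively E (z # ws)"
  using assms by (auto simp: successively_append_iff)

section \<open>Rainbow colourings\<close>

lemma rc_le:
  assumes "edge_colouring E k c" "rainbow_connected V E c"
  shows "rc V E \<le> k"
  unfolding rc_def using assms by (intro Least_le) blast

text \<open>With three colours a rainbow path has at most three edges, so these path lengths cover
  all that the colourings below can offer.\<close>

lemma rainbow_connectedI:
  assumes V: "\<And>u v. E u v \<Longrightarrow> u \<in> V \<and> v \<in> V"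
    and step: "\<And>x y. x \<in> V \<Longrightarrow> y \<in> V \<Longrightarrow> x \<noteq> y \<Longrightarrow> E x y
      \<or> (\<exists>z. E x z \<and> E z y \<and> distinct [x, z, y] \<and> c x z \<noteq> c z y)
      \<or> (\<exists>z w. E x z \<and> E z w \<and> E w y \<and> distinct [x, z, w, y] \<and> distinct [c x z, c z w, c w y])"
  shows "rainbow_connected V E c"
  unfolding rainbow_connected_def
proof (intro ballI impI)
  fix x y assume xy: "x \<in> V" "y \<in> V" "x \<noteq> y"
  have R: "\<exists>vs. gpath V E vs x y \<and> distinct (map (\<lambda>(a, b). c a b) (zip vs (tl vs)))"
    if "gpath V E vs x y \<and> distinct (map (\<lambda>(a, b). c a b) (zip vs (tl vs)))" for vs using that by blast
  consider "E x y" | z where "E x z \<and> E z y \<and> distinct [x, z, y] \<and> c x z \<noteq> c z y"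
    | z w where "E x z \<and> E z w \<and> E w y \<and> distinct [x, z, w, y] \<and> distinct [c x z, c z w, c w y]"
    using step[OF xy] by blast
  then show "\<exists>vs. gpath V E vs x y \<and> distinct (map (\<lambda>(a, b). c a b) (zip vs (tl vs)))"
  proof cases
    case 1
    show ?thesis by (rule R[of "[x, y]"]) (use 1 xy in \<open>auto simp: gpath_def walk_iff_successively\<close>)
  next
    case (2 z)
    show ?thesis by (rule R[of "[x, z, y]"]) (use 2 xy V[of x z] in \<open>auto simp: gpath_def walk_iff_successively\<close>)
  next
    case (3 z w)
    show ?thesis by (rule R[of "[x, z, w, y]"])
        (use 3 xy V[of z w] in \<open>auto simp: gpath_def walk_iff_successively\<close>)
  qed
qed

text \<open>A walk from \<open>u\<close> to \<open>v\<close> that avoids the edge \<open>u v\<close>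
  leaves \<open>u\<close> by another edge. This is how bridgelessness enters the proof.\<close>

lemma bridgeless_other_neighbour:
  assumes "simple_graph V E" "bridgeless V E" "E u v"
  obtains w where "E u w" "w \<noteq> v"
proof -
  obtain vs where w: "walk V (del_edge E u v) vs u v"
    using assms unfolding bridgeless_def is_bridge_def by blast
  have "u \<noteq> v" using assms unfolding simple_graph_def by blast
  then obtain w ws where "vs = u # w # ws"
    using w unfolding walk_iff_successively by (cases vs; cases "tl vs") auto
  then have "E u w" "w \<noteq> v" using w unfolding walk_iff_successively del_edge_def by auto
  then show ?thesis by (rule that)
qed

text \<open>A vertex violating the last property could be added to a set maximal under inclusion. As
  \<open>E\<close> is an arbitrary relation here, loops and both directions appear.\<close>

lemma maximal_independent_set:
  assumes "finite W"
  obtains I where "I \<subseteq> W" "\<And>x y. x \<in> I \<Longrightarrow> y \<in> I \<Longrightarrow> \<not> E x y"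
    "\<And>x. x \<in> W - I \<Longrightarrow> E x x \<or> (\<exists>y\<in>I. E x y \<or> E y x)"
proof -
  let ?S = "{I. I \<subseteq> W \<and> (\<forall>x\<in>I. \<forall>y\<in>I. \<not> E x y)}"
  have fin: "finite ?S" using assms by (auto intro: rev_finite_subset[of "Pow W"])
  have "?S \<noteq> {}" by blast
  from finite_has_maximal[OF fin this] obtain I where I: "I \<in> ?S" "\<forall>J\<in>?S. I \<subseteq> J \<longrightarrow> I = J"
    by (elim bexE)
  have "E x x \<or> (\<exists>y\<in>I. E x y \<or> E y x)" if "x \<in> W - I" for x
  proof (rule ccontr)
    assume "\<not> ?thesis"
    then have "insert x I \<in> ?S" using that I(1) by auto
    then have "I = insert x I" using I(2) by (metis (no_types, lifting) subset_insertI)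
    then show False using that by blast
  qed
  moreover have "I \<subseteq> W" "\<And>x y. x \<in> I \<Longrightarrow> y \<in> I \<Longrightarrow> \<not> E x y" using I(1) by simp_all
  ultimately show ?thesis using that by blast
qed

text \<open>Vertices of different classes are joined through \<open>v\<close> by edges coloured 0
  and 1. For two vertices of the same class, the path first crosses to the other class by an edge
  coloured 2 and then goes through \<open>v\<close>.\<close>

lemma rc_universal_vertex:
  assumes simple: "simple_graph V E" and v: "v \<in> V" "\<And>x. x \<in> V \<Longrightarrow> x \<noteq> v \<Longrightarrow> E v x"
    and deg: "\<And>x. x \<in> V \<Longrightarrow> x \<noteq> v \<Longrightarrow> \<exists>y. E x y \<and> y \<noteq> v"
  shows "\<exists>c. edge_colouring E 3 c \<and> rainbow_connected V E c"
proof -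
  have V: "\<And>u w. E u w \<Longrightarrow> u \<in> V \<and> w \<in> V" and sym: "\<And>u w. E u w \<Longrightarrow> E w u"
    and irr: "\<And>u. \<not> E u u" and fin: "finite V"
    using simple unfolding simple_graph_def by blast+
  obtain I where I: "I \<subseteq> V - {v}" "\<And>x y. x \<in> I \<Longrightarrow> y \<in> I \<Longrightarrow> \<not> E x y"
    "\<And>x. x \<in> V - {v} - I \<Longrightarrow> E x x \<or> (\<exists>y\<in>I. E x y \<or> E y x)"
    using maximal_independent_set[of "V - {v}" E] fin by blast
  \<comment> \<open>For \<open>x\<close> in \<open>I\<close>, the neighbour given by
    \<open>deg\<close> is outside \<open>I\<close> by independence; for \<open>x\<close> outside
    \<open>I\<close>, maximality gives a neighbour in \<open>I\<close>.\<close>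
  have opp: "\<exists>y. E x y \<and> y \<noteq> v \<and> (y \<in> I \<longleftrightarrow> x \<notin> I)" if "x \<in> V" "x \<noteq> v" for x
  proof (cases "x \<in> I")
    case True
    then show ?thesis using deg[OF that] I(2) by blast
  next
    case False
    then show ?thesis using I(1) I(3)[of x] that irr sym by blast
  qed
  define s :: "'a \<Rightarrow> nat" where "s x = (if x \<in> I then 1 else 0)" for x
  define c where "c a b = (if a = v then s b else if b = v then s a else 2)" for a b
  have "edge_colouring E 3 c"
    unfolding edge_colouring_def c_def s_def using irr by auto
  moreover have "rainbow_connected V E c"
  proof (rule rainbow_connectedI)
    fix x y assume xy: "x \<in> V" "y \<in> V" "x \<noteq> y"
    consider "x = v \<or> y = v" | "x \<noteq> v" "y \<noteq> v" "x \<in> I \<longleftrightarrow> y \<notin> I" | "x \<noteq> v" "y \<noteq> v" "x \<in> I \<longleftrightarrow> y \<in> I"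
      by blast
    then show "E x y
      \<or> (\<exists>z. E x z \<and> E z y \<and> distinct [x, z, y] \<and> c x z \<noteq> c z y)
      \<or> (\<exists>z w. E x z \<and> E z w \<and> E w y \<and> distinct [x, z, w, y] \<and> distinct [c x z, c z w, c w y])"
    proof cases
      case 1
      then show ?thesis using v sym xy by metis
    next
      case 2
      then have "E x v \<and> E v y \<and> distinct [x, v, y] \<and> c x v \<noteq> c v y"
        using v sym xy by (auto simp: c_def s_def)
      then show ?thesis by blast
    next
      case 3
      obtain z where z: "E x z" "z \<noteq> v" "z \<in> I \<longleftrightarrow> x \<notin> I" using opp[OF xy(1) 3(1)] by blast
      have "E x z \<and> E z v \<and> E v y \<and> distinct [x, z, v, y] \<and> distinct [c x z, c z v, c v y]"
        using v sym xy 3 z V[OF z(1)] by (auto simp: c_def s_def)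
      then show ?thesis by blast
    qed
  qed (use V in auto)
  ultimately show ?thesis by blast
qed

section \<open>Index arithmetic for cycles with short, non-crossing chords\<close>

lemma Ex_less_numeral:
  fixes P :: "nat \<Rightarrow> bool"
  shows "(\<exists>k<7. P k) \<longleftrightarrow> P 0 \<or> P 1 \<or> P 2 \<or> P 3 \<or> P 4 \<or> P 5 \<or> P 6"
    and "(\<exists>k<8. P k) \<longleftrightarrow> P 0 \<or> P 1 \<or> P 2 \<or> P 3 \<or> P 4 \<or> P 5 \<or> P 6 \<or> P 7"
  by (auto simp: numeral_eq_Suc less_Suc_eq)

text \<open>Here \<open>e\<close> is adjacency of positions on a cycle of length \<open>n\<close>,
  and \<open>short\<close> allows only cyclic distance 1 or 2. Positions further apart need a common
  neighbour, which forces chords between positions two apart; for \<open>n\<close> at least 7 some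
  of these cross.\<close>

lemma short_chords_bound:
  fixes e :: "nat \<Rightarrow> nat \<Rightarrow> bool"
  assumes sym: "\<And>i j. e i j \<longleftrightarrow> e j i"
    and short: "\<And>i j. i < j \<Longrightarrow> j < n \<Longrightarrow> e i j \<Longrightarrow> j - i \<le> 2 \<or> n - 2 \<le> j - i"
    and nested: "\<And>i j k l. i < k \<Longrightarrow> k < j \<Longrightarrow> j < l \<Longrightarrow> l < n \<Longrightarrow> e i j \<Longrightarrow> \<not> e k l"
    and common: "\<And>i j. i < j \<Longrightarrow> j < n \<Longrightarrow> e i j \<or> (\<exists>k<n. k \<noteq> i \<and> k \<noteq> j \<and> e i k \<and> e k j)"
  shows "n \<le> 6"
proof (rule ccontr)
  assume "\<not> n \<le> 6"
  then consider "n = 7" | "n = 8" | "n \<ge> 9" by linarith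
  then show False
  proof cases
    case 1
    have N: "\<not> e 0 3" "\<not> e 0 4" "\<not> e 1 4" "\<not> e 1 5" "\<not> e 2 5" "\<not> e 2 6" "\<not> e 3 6"
      using 1 short[of 0 3] short[of 0 4] short[of 1 4] short[of 1 5] short[of 2 5] short[of 2 6]
        short[of 3 6] by auto
    have S: "e 3 0 = e 0 3" "e 4 0 = e 0 4" "e 4 1 = e 1 4" "e 5 1 = e 1 5" "e 5 2 = e 2 5" "e 6 2 = e 2 6"
      "e 6 3 = e 3 6" "e 2 0 = e 0 2" "e 3 1 = e 1 3" "e 4 2 = e 2 4" "e 5 3 = e 3 5" "e 6 4 = e 4 6"
      "e 5 0 = e 0 5" "e 6 1 = e 1 6"
      by (rule sym)+
    \<comment> \<open>Each of the seven pairs at cyclic distance 3 forces one of two consecutive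
      short chords, or both chords of the detour the other way round. Consecutive short chords
      cross, and the resulting propositional formula in the seven chords is unsatisfiable.\<close>
    have "e 0 2 \<or> e 1 3 \<or> e 3 5 \<and> e 0 5" using common[of 0 3] N S 1 by (auto simp: Ex_less_numeral)
    moreover have "e 1 3 \<or> e 2 4 \<or> e 4 6 \<and> e 1 6" using common[of 1 4] N S 1 by (auto simp: Ex_less_numeral)
    moreover have "e 2 4 \<or> e 3 5 \<or> e 0 5 \<and> e 0 2" using common[of 2 5] N S 1 by (auto simp: Ex_less_numeral)
    moreover have "e 3 5 \<or> e 4 6 \<or> e 1 6 \<and> e 1 3" using common[of 3 6] N S 1 by (auto simp: Ex_less_numeral)
    moreover have "e 4 6 \<or> e 0 5 \<or> e 0 2 \<and> e 2 4" using common[of 0 4] N S 1 by (auto simp: Ex_less_numeral)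
    moreover have "e 0 5 \<or> e 1 6 \<or> e 1 3 \<and> e 3 5" using common[of 1 5] N S 1 by (auto simp: Ex_less_numeral)
    moreover have "e 1 6 \<or> e 0 2 \<or> e 2 4 \<and> e 4 6" using common[of 2 6] N S 1 by (auto simp: Ex_less_numeral)
    moreover have "\<not> (e 0 2 \<and> e 1 3)" "\<not> (e 1 3 \<and> e 2 4)" "\<not> (e 2 4 \<and> e 3 5)" "\<not> (e 3 5 \<and> e 4 6)"
      "\<not> (e 0 5 \<and> e 4 6)" "\<not> (e 0 5 \<and> e 1 6)" "\<not> (e 0 2 \<and> e 1 6)"
      using 1 nested[of 0 1 2 3] nested[of 1 2 3 4] nested[of 2 3 4 5] nested[of 3 4 5 6]
        nested[of 0 4 5 6] nested[of 0 1 5 6] nested[of 0 1 2 6] by auto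
    ultimately show False by argo
  next
    case 2
    have N: "\<not> e 0 3" "\<not> e 0 4" "\<not> e 1 4" "\<not> e 1 5" "\<not> e 0 5" "\<not> e 4 7" "\<not> e 1 6" "\<not> e 2 5"
      using 2 short[of 0 3] short[of 0 4] short[of 1 4] short[of 1 5] short[of 0 5] short[of 4 7]
        short[of 1 6] short[of 2 5] by auto
    have S: "e 3 0 = e 0 3" "e 4 0 = e 0 4" "e 4 1 = e 1 4" "e 5 1 = e 1 5" "e 5 0 = e 0 5" "e 7 4 = e 4 7"
      "e 6 1 = e 1 6" "e 6 4 = e 4 6" "e 7 5 = e 5 7" "e 5 2 = e 2 5" "e 1 0 = e 0 1"
      by (rule sym)+
    \<comment> \<open>Antipodal positions are joined by two chords on one side or the other; each
      choice for the pair 0, 4 crosses each choice for 1, 5.\<close>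
    have "e 0 2 \<and> e 2 4 \<or> e 0 6 \<and> e 4 6" using common[of 0 4] N S 2 by (auto simp: Ex_less_numeral)
    moreover have "e 1 3 \<and> e 3 5 \<or> e 1 7 \<and> e 5 7" using common[of 1 5] N S 2 by (auto simp: Ex_less_numeral)
    moreover have "\<not> (e 0 2 \<and> e 1 3)" "\<not> (e 0 2 \<and> e 1 7)" "\<not> (e 4 6 \<and> e 5 7)" "\<not> (e 3 5 \<and> e 4 6)"
      using 2 nested[of 0 1 2 3] nested[of 0 1 2 7] nested[of 4 5 6 7] nested[of 3 4 5 6] by auto
    ultimately show False by argo
  next
    case 3
    \<comment> \<open>For \<open>n\<close> at least 9 the way back from \<open>i + 4\<close> to
      \<open>i\<close> has length at least 5, too long for two steps of length at most 2, so the
      common neighbour is the midpoint. The chords for \<open>i = 0\<close> and \<open>i = 1\<close>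
      then cross.\<close>
    have mid: "e i (i + 2) \<and> e (i + 2) (i + 4)" if i: "i \<le> 1" for i
    proof -
      have "\<not> e i (i + 4)" using short[of i "i + 4"] 3 i by auto
      then obtain k where k: "k < n" "k \<noteq> i" "k \<noteq> i + 4" "e i k" "e k (i + 4)"
        using common[of i "i + 4"] 3 i by auto
      have "k = i + 2"
      proof (rule linorder_cases[of k i])
        assume "k < i"
        then show ?thesis using short[of k "i + 4"] k i 3 by auto
      next
        assume "i < k"
        then have a: "k - i \<le> 2 \<or> n - 2 \<le> k - i" using short[of i k] k by auto
        show ?thesis
        proof (cases "k < i + 4")
          case True
          then have "i + 4 - k \<le> 2 \<or> n - 2 \<le> i + 4 - k" using short[of k "i + 4"] k i 3 by auto
          then show ?thesis using a True \<open>i < k\<close> i 3 by arith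
        next
          case False
          then have "k - (i + 4) \<le> 2 \<or> n - 2 \<le> k - (i + 4)" using short[of "i + 4" k] k sym by auto
          then show ?thesis using a False \<open>i < k\<close> i 3 k(1,3) by arith
        qed
      qed (use k in auto)
      then show ?thesis using k by simp
    qed
    show False using mid[of 0] mid[of 1] nested[of 0 1 2 3] 3 by (simp add: numeral_eq_Suc)
  qed
qed

section \<open>Cycles and chords in graphs without thetas\<close>

definition cyc :: "('a \<Rightarrow> 'a \<Rightarrow> bool) \<Rightarrow> 'a list \<Rightarrow> bool" where
  "cyc E C \<longleftrightarrow> distinct C \<and> 3 \<le> length C \<and> successively E C \<and> E (last C) (hd C)"

lemma cyc_rotate: "cyc E (xs @ ys) \<Longrightarrow> cyc E (ys @ xs)"
  unfolding cyc_def by (cases "xs = []"; cases "ys = []") (auto simp: successively_append_iff)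

text \<open>Rotates the cycle to start at position \<open>i\<close>; \<open>A\<close> is the stretch
  between \<open>i\<close> and \<open>j\<close>, and \<open>B\<close> runs from behind
  \<open>j\<close> around to just before \<open>i\<close>.\<close>

lemma cyc_split_nth:
  assumes "cyc E C" "i < j" "j < length C"
  obtains A B where "cyc E (C ! i # A @ C ! j # B)" "set (C ! i # A @ C ! j # B) = set C"
    "length A = j - i - 1" "length B = length C - (j - i) - 1"
    "\<And>k. i < k \<Longrightarrow> k < j \<Longrightarrow> C ! k \<in> set A" "\<And>l. j < l \<Longrightarrow> l < length C \<Longrightarrow> C ! l \<in> set B"
proof -
  define P where "P = take i C"
  define A where "A = take (j - i - 1) (drop (Suc i) C)"
  define Q where "Q = drop (Suc j) C"
  have "C = P @ C ! i # drop (Suc i) C" unfolding P_def using assms by (intro id_take_nth_drop) simp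
  also have "drop (Suc i) C = A @ drop (Suc i) C ! (j - i - 1) # drop (Suc (j - i - 1)) (drop (Suc i) C)"
    unfolding A_def using assms by (intro id_take_nth_drop) simp
  finally have C: "C = P @ C ! i # A @ C ! j # Q"
    unfolding Q_def using assms by simp
  show ?thesis
  proof (rule that)
    show "cyc E (C ! i # A @ C ! j # (Q @ P))"
      using cyc_rotate[of E P "C ! i # A @ C ! j # Q"] C assms(1) by simp
    show "set (C ! i # A @ C ! j # (Q @ P)) = set C" using arg_cong[OF C, of set] by auto
    show "length A = j - i - 1" unfolding A_def using assms by simp
    show "length (Q @ P) = length C - (j - i) - 1" unfolding P_def Q_def using assms by simp
  next
    fix k assume "i < k" "k < j"
    then have "C ! k = A ! (k - i - 1)" "k - i - 1 < length A" unfolding A_def using assms by auto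
    then show "C ! k \<in> set A" by simp
  next
    fix l assume "j < l" "l < length C"
    then have "C ! l = Q ! (l - j - 1)" "l - j - 1 < length Q" unfolding Q_def using assms by auto
    then show "C ! l \<in> set (Q @ P)" by simp
  qed
qed

context
  fixes V :: "'a set" and E :: "'a \<Rightarrow> 'a \<Rightarrow> bool"
  assumes simple: "simple_graph V E" and theta_free: "theta_free E"
begin

lemma in_V: "E u v \<Longrightarrow> u \<in> V" "E u v \<Longrightarrow> v \<in> V"
  using simple unfolding simple_graph_def by blast+

lemma E_sym: "E u v \<Longrightarrow> E v u"
  using simple unfolding simple_graph_def by blast

lemma E_comm: "E u v \<longleftrightarrow> E v u"
  using E_sym by blast

lemma E_irrefl: "\<not> E u u"
  using simple unfolding simple_graph_def by blast

lemma successively_rev_E: "successively (\<lambda>x y. E y x) = successively E"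
  using E_comm by presburger

lemma cyc_rev: "cyc E C \<Longrightarrow> cyc E (rev C)"
  unfolding cyc_def by (simp add: hd_rev last_rev successively_rev_E E_comm)

lemma cyc_subset: "cyc E C \<Longrightarrow> set C \<subseteq> V"
proof
  fix x assume C: "cyc E C" and "x \<in> set C"
  then obtain i where i: "i < length C" "x = C ! i" by (auto simp: in_set_conv_nth)
  show "x \<in> V"
  proof (cases "Suc i < length C")
    case True
    then show ?thesis using C i in_V successively_nth[of E C i] unfolding cyc_def by blast
  next
    case False
    then have "x = last C" using i by (metis Suc_lessI diff_Suc_1 last_conv_nth list.size(3) not_less_zero)
    then show ?thesis using C in_V unfolding cyc_def by blast
  qed
qed

lemma cyc_split:
  assumes "cyc E C" "a \<in> set C" "b \<in> set C" "a \<noteq> b"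
  obtains A B where "cyc E (a # A @ b # B)" "set (a # A @ b # B) = set C" "length (a # A @ b # B) = length C"
proof -
  obtain i j where ij: "i < length C" "j < length C" "a = C ! i" "b = C ! j" "i \<noteq> j"
    using assms by (metis in_set_conv_nth)
  show ?thesis
  proof (cases "i < j")
    case True
    show ?thesis by (rule cyc_split_nth[OF assms(1) True]) (use ij True that in auto)
  next
    case False
    then have ji: "j < i" using ij by simp
    obtain A B where AB: "cyc E (b # A @ a # B)" "set (b # A @ a # B) = set C"
      "length A = i - j - 1" "length B = length C - (i - j) - 1"
      using cyc_split_nth[OF assms(1) ji ij(1)] ij by metis
    have "cyc E (a # B @ b # A)" using cyc_rotate[of E "b # A" "a # B"] AB by simp
    then show ?thesis
    proof (rule that)
      show "set (a # B @ b # A) = set C" using AB(2) by auto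
      show "length (a # B @ b # A) = length C" using AB(3,4) ji ij by simp
    qed
  qed
qed

text \<open>If \<open>a\<close> and \<open>b\<close> are consecutive on the cycle, the ear replaces
  their edge and makes the cycle longer. Otherwise the ear and the two sides of the cycle form a
  theta.\<close>

lemma no_ear:
  assumes C: "cyc E C" and longest: "\<And>D. cyc E D \<Longrightarrow> length D \<le> length C"
    and ab: "a \<in> set C" "b \<in> set C" "a \<noteq> b"
    and ps: "ps \<noteq> []" "distinct ps" "set ps \<inter> set C = {}" "successively E (a # ps @ [b])"
  shows False
proof -
  obtain A B where AB: "cyc E (a # A @ b # B)" "set (a # A @ b # B) = set C"
    "length (a # A @ b # B) = length C" using cyc_split[OF C ab] .
  note D = AB(1)[unfolded cyc_def]
  have dj: "set ps \<inter> set (a # A @ b # B) = {}" using ps AB by simp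
  have p: "successively E ps" "E a (hd ps)" "E (last ps) b"
    using ps by (auto simp: successively_append_iff successively_Cons)
  consider "A = []" | "B = []" | "A \<noteq> []" "B \<noteq> []" by blast
  then show False
  proof cases
    case 1
    have "cyc E (a # ps @ b # B)"
      using 1 D dj p ps unfolding cyc_def by (auto simp: successively_append_iff successively_Cons)
    then have "length (a # ps @ b # B) \<le> length C" by (rule longest)
    then show False using AB(3)[symmetric] 1 ps(1) by simp
  next
    case 2
    have "cyc E (a # A @ b # rev ps)"
      using 2 D dj p ps(1,2) E_sym[OF p(2)] E_sym[OF p(3)] unfolding cyc_def
      by (auto simp: successively_append_iff successively_Cons hd_rev last_rev hd_append successively_rev_E)
    then have "length (a # A @ b # rev ps) \<le> length C" by (rule longest)
    then show False using AB(3)[symmetric] 2 ps(1) by simp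
  next
    case 3
    have "successively E ((a # A) @ b # B)" using D by simp
    note q = successively_cut[OF this]
    have "successively E (b # B @ [a])"
      using q(2) D successively_append_iff[of E "b # B" "[a]"] by simp
    then have "successively E (rev (b # B @ [a]))"
      by (simp only: successively_rev successively_rev_E)
    then have r: "successively E (a # rev B @ [b])" by simp
    show False
      by (rule theta_freeD[OF theta_free, of A "rev B" ps a b]) (use 3 D dj ps q r in auto)
  qed
qed

text \<open>A nonempty stretch between two consecutive ends of the chords is one path of a theta;
  each of the other two paths uses one chord and one neighbouring stretch. With all stretches empty
  the graph on these four vertices could be K_4, which has no theta.\<close>

lemma no_crossing_chords:
  assumes C: "cyc E (a # A @ x # A' @ b # B @ y # B')" and ne: "A \<noteq> [] \<or> A' \<noteq> [] \<or> B \<noteq> [] \<or> B' \<noteq> []"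
    and E: "E a b" "E x y"
  shows False
proof -
  note D = C[unfolded cyc_def]
  have dist: "distinct (a # A @ x # A' @ b # B @ y # B')" using D by (elim conjE)
  have p: "successively E (a # A @ [x])" "successively E (x # A' @ [b])"
    "successively E (b # B @ [y])" "successively E (y # B' @ [a])"
  proof -
    have C': "successively E ((a # A) @ x # A' @ b # B @ y # B')" using D by simp
    show "successively E (a # A @ [x])" using successively_cut(1)[OF C'] by simp
    have C': "successively E ((x # A') @ b # B @ y # B')" using successively_cut(2)[OF C'] by simp
    show "successively E (x # A' @ [b])" using successively_cut(1)[OF C'] by simp
    have C': "successively E ((b # B) @ y # B')" using successively_cut(2)[OF C'] by simp
    show "successively E (b # B @ [y])" using successively_cut(1)[OF C'] by simp
    have "successively E (y # B')" using successively_cut(2)[OF C'] .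
    moreover have "E (last (y # B')) a" using D by simp
    ultimately show "successively E (y # B' @ [a])"
      using successively_append_iff[of E "y # B'" "[a]"] by simp
  qed
  then have "successively E (rev (a # A @ [x]))" "successively E (rev (x # A' @ [b]))"
    "successively E (rev (b # B @ [y]))" "successively E (rev (y # B' @ [a]))"
    by (simp_all only: successively_rev successively_rev_E)
  then have r: "successively E (x # rev A @ [a])" "successively E (b # rev A' @ [x])"
    "successively E (y # rev B @ [b])" "successively E (a # rev B' @ [y])"
    by simp_all
  have snoc: "successively E ((u # vs @ [w]) @ [z])" if "successively E (u # vs @ [w])" "E w z" for u vs w z
    using that unfolding successively_append_iff by simp
  have S: "E b a" "E y x" using E E_sym by auto
  from ne consider "A \<noteq> []" | "A' \<noteq> []" | "B \<noteq> []" | "B' \<noteq> []" by blast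
  then show False
  proof cases
    case 1
    show False by (rule theta_freeD[OF theta_free, of A "b # rev A'" "rev B' @ [y]" a x])
        (use 1 dist p(1) r(2) snoc[OF r(4) S(2)] E in auto)
  next
    case 2
    show False by (rule theta_freeD[OF theta_free, of A' "y # rev B" "rev A @ [a]" x b])
        (use 2 dist p(2) r(3) snoc[OF r(1) E(1)] E in auto)
  next
    case 3
    show False by (rule theta_freeD[OF theta_free, of B "a # rev B'" "rev A' @ [x]" b y])
        (use 3 dist p(3) r(4) snoc[OF r(2) E(2)] S in auto)
  next
    case 4
    show False by (rule theta_freeD[OF theta_free, of B' "x # rev A" "rev B @ [b]" y a])
        (use 4 dist p(4) r(1) snoc[OF r(3) S(1)] S in auto)
  qed
qed

lemma no_crossing_chords_set:
  assumes C: "cyc E (a # A @ b # B)" and len: "length A + length B \<ge> 3"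
    and xy: "x \<in> set A" "y \<in> set B" and ab: "E a b"
  shows "\<not> E x y"
proof
  assume xyE: "E x y"
  obtain A1 A2 B1 B2 where AB: "A = A1 @ x # A2" "B = B1 @ y # B2"
    using xy by (meson split_list)
  then have "A1 \<noteq> [] \<or> A2 \<noteq> [] \<or> B1 \<noteq> [] \<or> B2 \<noteq> []" using len by auto
  with AB show False using no_crossing_chords[of a A1 x A2 b B1 y B2] C ab xyE \<open>A1 \<noteq> [] \<or> A2 \<noteq> [] \<or> B1 \<noteq> [] \<or> B2 \<noteq> []\<close>
    by auto
qed

section \<open>Diameter two without a universal vertex\<close>

context
  assumes diam: "x \<in> V \<Longrightarrow> y \<in> V \<Longrightarrow> x \<noteq> y \<Longrightarrow> E x y \<or> (\<exists>z. E x z \<and> E z y)"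
    and no_universal: "v \<in> V \<Longrightarrow> \<exists>x\<in>V. x \<noteq> v \<and> \<not> E v x"
begin

text \<open>All vertices off \<open>C\<close> that have neighbours on \<open>C\<close> attach at the
  same vertex \<open>u\<close>, since otherwise a short connection would give an ear. Paths of
  length at most 2 between a vertex off \<open>C\<close> and a vertex of \<open>C\<close> other than
  \<open>u\<close> then pass through \<open>u\<close>, which makes \<open>u\<close>
  universal.\<close>

lemma longest_cycle_Hamiltonian:
  assumes C: "cyc E C" and longest: "\<And>D. cyc E D \<Longrightarrow> length D \<le> length C"
  shows "set C = V"
proof (rule ccontr)
  assume "set C \<noteq> V"
  then obtain w\<^sub>0 where w0: "w\<^sub>0 \<in> V" "w\<^sub>0 \<notin> set C" using cyc_subset[OF C] by blast
  have uniq1: "c = c'" if "w \<notin> set C" "E w c" "E w c'" "c \<in> set C" "c' \<in> set C" for w c c'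
    using no_ear[OF C longest, of c c' "[w]"] that E_sym by auto
  have uniq: "c = c'" if w: "w \<notin> set C" "E w c" "c \<in> set C" and z: "z \<notin> set C" "E z c'" "c' \<in> set C" for w z c c'
  proof (rule ccontr)
    assume ne: "c \<noteq> c'"
    then have "w \<noteq> z" using uniq1 w z by blast
    then consider "E w z" | y where "E w y" "E y z" using diam w z in_V by meson
    then show False
    proof cases
      case 1
      then show False using no_ear[OF C longest, of c c' "[w, z]"] w z ne E_sym \<open>w \<noteq> z\<close> by auto
    next
      case (2 y)
      show False
      proof (cases "y \<in> set C")
        case True
        then show False using uniq1[of w c y] uniq1[of z c' y] w z 2 E_sym ne by blast
      next
        case False
        moreover have "w \<noteq> y" "y \<noteq> z" using 2 E_irrefl by auto
        ultimately show False
          using no_ear[OF C longest, of c c' "[w, y, z]"] w z ne 2 E_sym \<open>w \<noteq> z\<close> by auto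
      qed
    qed
  qed
  \<comment> \<open>Either \<open>w\<^sub>0\<close> itself has a neighbour on the cycle, or the
    middle vertex of a path of length 2 to the cycle is on it or next to it.\<close>
  obtain w u where w: "w \<notin> set C" "E w u" "u \<in> set C"
  proof -
    obtain c where c: "c \<in> set C" using C unfolding cyc_def by fastforce
    then have "c \<noteq> w\<^sub>0" "c \<in> V" using w0 cyc_subset[OF C] by auto
    then consider "E w\<^sub>0 c" | z where "E w\<^sub>0 z" "E z c" using diam w0 by blast
    then show thesis using that w0 c by (cases; metis)
  qed
  have "E u x" if x: "x \<in> V" "x \<noteq> u" for x
  proof (cases "x \<in> set C")
    case True
    then have "\<not> E w x" "w \<noteq> x" using uniq1 w x by blast+
    then obtain z where z: "E w z" "E z x" using diam[of w x] x in_V w by blast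
    show ?thesis
    proof (cases "z \<in> set C")
      case True
      then show ?thesis using uniq1 w z by blast
    next
      case False
      then show ?thesis using uniq[OF w False z(2) \<open>x \<in> set C\<close>] x by blast
    qed
  next
    case False
    obtain c where c: "c \<in> set C" "c \<noteq> u"
    proof -
      have "card (set C) \<ge> 3" using C unfolding cyc_def by (simp add: distinct_card)
      then have "\<not> set C \<subseteq> {u}" using card_mono[of "{u}" "set C"] by auto
      then show thesis using that by blast
    qed
    then have "\<not> E x c" "x \<noteq> c" using uniq[OF w, of x c] False by blast+
    then obtain z where z: "E x z" "E z c" using diam[of x c] x c cyc_subset[OF C] by blast
    show ?thesis
    proof (cases "z \<in> set C")
      case True
      then show ?thesis using uniq[OF w False z(1)] z E_sym by blast
    next
      case False
      then show ?thesis using uniq[OF w False z(2)] c by blast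
    qed
  qed
  then show False using no_universal[of u] w in_V by blast
qed

text \<open>Start from nonadjacent \<open>u\<close> and \<open>x\<close> with common neighbour
  \<open>y\<close>, and a second neighbour \<open>z\<close> of \<open>x\<close>. A connection of
  length at most 2 from \<open>z\<close> back to \<open>u\<close> closes a cycle of length 3, 4 or
  5.\<close>

lemma cycle_exists:
  assumes deg: "\<And>u v. E u v \<Longrightarrow> \<exists>w. E u w \<and> w \<noteq> v" and ne: "V \<noteq> {}"
  shows "\<exists>C. cyc E C"
proof -
  obtain u where u: "u \<in> V" using ne by blast
  obtain x where x: "x \<in> V" "x \<noteq> u" "\<not> E u x" using no_universal[OF u] by blast
  obtain y where y: "E u y" "E y x" using diam[of u x] u x by blast
  obtain z where z: "E x z" "z \<noteq> y" using deg[of x y] y E_sym by blast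
  note irr = E_irrefl and sym = E_comm
  have zu: "z \<noteq> u" using x z sym by blast
  consider "E z u" | "E z y" | t where "\<not> E z u" "E z t" "E t u"
    using diam[of z u] z u in_V zu by blast
  then show ?thesis
  proof cases
    case 1
    have "cyc E [u, y, x, z]" unfolding cyc_def using 1 u x y z zu irr by (auto simp: sym)
    then show ?thesis ..
  next
    case 2
    have "cyc E [x, z, y]" unfolding cyc_def using 2 u x y z irr by (auto simp: sym)
    then show ?thesis ..
  next
    case (3 t)
    show ?thesis
    proof (cases "t = y")
      case True
      have "cyc E [x, z, y]" unfolding cyc_def using 3 True u x y z irr by (auto simp: sym)
      then show ?thesis ..
    next
      case False
      have "t \<noteq> x" using 3 x sym by blast
      then have "cyc E [u, y, x, z, t]" unfolding cyc_def using 3 False u x y z zu irr by (auto simp: sym)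
      then show ?thesis ..
    qed
  qed
qed

lemma Hamiltonian_cycle_exists:
  assumes deg: "\<And>u v. E u v \<Longrightarrow> \<exists>w. E u w \<and> w \<noteq> v" and ne: "V \<noteq> {}"
  obtains C where "cyc E C" "set C = V"
proof -
  have fin: "finite V" using simple unfolding simple_graph_def by blast
  have bound: "\<forall>C. cyc E C \<longrightarrow> length C < Suc (card V)"
  proof (intro allI impI)
    fix C assume C: "cyc E C"
    then show "length C < Suc (card V)"
      using card_mono[OF fin cyc_subset[OF C]] unfolding cyc_def by (simp add: distinct_card)
  qed
  obtain C\<^sub>0 where C0: "cyc E C\<^sub>0" using cycle_exists[OF deg ne] by blast
  obtain C where "cyc E C" "\<And>D. cyc E D \<Longrightarrow> length D \<le> length C"
    using ex_has_greatest_nat[of "cyc E" C\<^sub>0 length, OF C0 bound] by blast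
  then show ?thesis using that longest_cycle_Hamiltonian by blast
qed

text \<open>No edge runs between \<open>A\<close> and \<open>B\<close>, as it would cross the chord;
  so a common neighbour of \<open>x\<close> and \<open>y\<close> can only be \<open>a\<close> or
  \<open>b\<close>.\<close>

lemma chord_common_neighbour:
  assumes C: "cyc E (a # A @ b # B)" "set (a # A @ b # B) = V" and len: "length A + length B \<ge> 3"
    and ab: "E a b" and xy: "x \<in> set A" "y \<in> set B"
  shows "E a x \<and> E a y \<or> E b x \<and> E b y"
proof -
  have cross: "\<not> E p q" if "p \<in> set A" "q \<in> set B" for p q
    using no_crossing_chords_set[OF C(1) len that ab] .
  have ne: "x \<noteq> y" using C xy unfolding cyc_def by auto
  have V: "x \<in> V" "y \<in> V" unfolding C(2)[symmetric] using xy by auto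
  obtain z where z: "E x z" "E z y" using diam[OF V ne] cross[OF xy] by blast
  have "z \<in> insert a (insert b (set A \<union> set B))" using in_V(2)[OF z(1)] C(2) by auto
  moreover have "z \<notin> set A" "z \<notin> set B" using z cross xy by blast+
  ultimately have "z = a \<or> z = b" by blast
  then show ?thesis using z E_sym by blast
qed

text \<open>As \<open>a\<close> misses \<open>s\<close>, every vertex of \<open>B\<close> is
  adjacent to \<open>b\<close>. But \<open>b\<close> is not universal either, and a vertex it misses
  must lie in \<open>A\<close>, so every vertex of \<open>B\<close> is also adjacent to
  \<open>a\<close>. Two vertices of \<open>B\<close> together with the path through \<open>A\<close>
  would form a theta between \<open>a\<close> and \<open>b\<close>.\<close>

lemma short_side:
  assumes C: "cyc E (a # A @ b # B)" "set (a # A @ b # B) = V" and len: "length A + length B \<ge> 3"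
    and ab: "E a b" and ne: "A \<noteq> []" "B \<noteq> []" and s: "s \<in> set A" "\<not> E a s"
  shows "length B = 1"
proof (rule ccontr)
  assume "length B \<noteq> 1"
  then obtain y y' B' where B: "B = y # y' # B'" using ne by (cases B; cases "tl B") auto
  note comm = chord_common_neighbour[OF C len ab]
  have b: "E b q" if "q \<in> set B" for q using comm[OF s(1) that] s(2) by blast
  obtain t where t: "t \<in> V" "t \<noteq> b" "\<not> E b t" using no_universal[of b] C(2) by auto
  then have "t \<in> set A" using b ab E_sym C(2) by auto
  then have a: "E a q" if "q \<in> set B" for q using comm[OF _ that] t by blast
  show False
    by (rule theta_freeD[OF theta_free, of "[y]" "[y']" A a b])
      (use C(1) B a[of y] b[of y] a[of y'] b[of y'] ne E_sym in 
        \<open>auto simp: cyc_def successively_append_iff successively_Cons\<close>)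
qed

lemma chord_cuts_vertex:
  assumes C: "cyc E (a # A @ b # B)" "set (a # A @ b # B) = V" and len: "length A + length B \<ge> 3"
    and ab: "E a b" and ne: "A \<noteq> []" "B \<noteq> []"
  shows "length A = 1 \<or> length B = 1"
proof -
  obtain s where s: "s \<in> V" "s \<noteq> a" "\<not> E a s" using no_universal[of a] C(2) by auto
  then have "s \<in> set A \<or> s \<in> set B" using ab C(2) by auto
  then show ?thesis
  proof
    assume "s \<in> set A"
    then show ?thesis using short_side[OF C len ab ne] s by blast
  next
    assume sB: "s \<in> set B"
    \<comment> \<open>Reversing the cycle exchanges the two sides of the chord, so
      \<open>short_side\<close> applies again.\<close>
    have "cyc E (rev (A @ b # B) @ [a])" using cyc_rev[OF C(1)] by simp
    from cyc_rotate[OF this] have "cyc E (a # rev B @ b # rev A)" by simp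
    moreover have "set (a # rev B @ b # rev A) = V" using C(2) by auto
    ultimately have "length (rev A) = 1"
      by (rule short_side) (use len ab ne sB s in auto)
    then show ?thesis by simp
  qed
qed

text \<open>A side with one vertex means cyclic distance 2; an empty side means that the edge
  belongs to the cycle itself.\<close>

lemma chord_length:
  assumes C: "cyc E C" "set C = V" "5 \<le> length C" and ij: "i < j" "j < length C" "E (C ! i) (C ! j)"
  shows "j - i \<le> 2 \<or> length C - 2 \<le> j - i"
proof -
  obtain A B where AB: "cyc E (C ! i # A @ C ! j # B)" "set (C ! i # A @ C ! j # B) = set C"
    "length A = j - i - 1" "length B = length C - (j - i) - 1"
    using cyc_split_nth[OF C(1) ij(1,2)] .
  have len: "length A + length B \<ge> 3" using AB ij C by simp
  have "A = [] \<or> B = [] \<or> length A = 1 \<or> length B = 1"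
    using chord_cuts_vertex[OF AB(1) _ len ij(3)] AB(2) C(2) by auto
  then have "length A \<le> 1 \<or> length B \<le> 1" by auto
  then show ?thesis using AB ij by arith
qed

lemma chords_nested:
  assumes C: "cyc E C" "5 \<le> length C" and ij: "i < k" "k < j" "j < l" "l < length C"
    and E: "E (C ! i) (C ! j)"
  shows "\<not> E (C ! k) (C ! l)"
proof -
  have "i < j" "j < length C" using ij by auto
  from cyc_split_nth[OF C(1) this] obtain A B where AB: "cyc E (C ! i # A @ C ! j # B)"
    "length A = j - i - 1" "length B = length C - (j - i) - 1"
    "C ! k \<in> set A" "C ! l \<in> set B" using ij by metis
  then show ?thesis using no_crossing_chords_set[OF AB(1) _ AB(4,5) E] ij C(2) by simp
qed

lemma Hamiltonian_cycle_length:
  assumes C: "cyc E C" "set C = V"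
  shows "length C \<le> 6"
proof (rule ccontr)
  assume n: "\<not> length C \<le> 6"
  have "length C \<le> 6"
  proof (rule short_chords_bound[of "\<lambda>i j. E (C ! i) (C ! j)"])
    show "E (C ! i) (C ! j) \<longleftrightarrow> E (C ! j) (C ! i)" for i j by (rule E_comm)
    show "j - i \<le> 2 \<or> length C - 2 \<le> j - i" if "i < j" "j < length C" "E (C ! i) (C ! j)" for i j
      using chord_length[OF C _ that] n by simp
    show "\<not> E (C ! k) (C ! l)" if "i < k" "k < j" "j < l" "l < length C" "E (C ! i) (C ! j)" for i j k l
      using chords_nested[OF C(1) _ that] n by simp
    show "E (C ! i) (C ! j) \<or> (\<exists>k<length C. k \<noteq> i \<and> k \<noteq> j \<and> E (C ! i) (C ! k) \<and> E (C ! k) (C ! j))"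
      if ij: "i < j" "j < length C" for i j
    proof -
      have "C ! i \<noteq> C ! j" using C(1) ij unfolding cyc_def by (simp add: nth_eq_iff_index_eq)
      moreover have "C ! i \<in> V" "C ! j \<in> V" using ij C(2) by auto
      ultimately consider "E (C ! i) (C ! j)" | z where "E (C ! i) z" "E z (C ! j)" using diam by blast
      then show ?thesis
      proof cases
        case (2 z)
        then obtain k where "k < length C" "z = C ! k" using in_V C(2) by (metis in_set_conv_nth)
        then show ?thesis using 2 E_irrefl by blast
      qed blast
    qed
  qed
  then show False using n by simp
qed

end

end

section \<open>Colouring a Hamiltonian cycle and the conclusion\<close>

text \<open>With edge \<open>i\<close> coloured \<open>i mod 3\<close>, any three consecutive edges
  along the list have distinct colours; the few pairs further apart are joined across the closing
  edge.\<close>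

lemma rainbow_connected_Hamiltonian_cycle:
  assumes simple: "simple_graph V E" and C: "cyc E C" "set C = V" "length C \<le> 6"
  shows "\<exists>c. edge_colouring E 3 c \<and> rainbow_connected V E c"
proof -
  have V: "\<And>u w. E u w \<Longrightarrow> u \<in> V \<and> w \<in> V" and sym: "\<And>u w. E u w \<Longrightarrow> E w u"
    using simple unfolding simple_graph_def by blast+
  define n where "n = length C"
  have n: "3 \<le> n" "n \<le> 6" using C unfolding cyc_def n_def by auto
  have nth_eq: "C ! i = C ! j \<longleftrightarrow> i = j" if "i < n" "j < n" for i j
    using C(1) that unfolding cyc_def n_def by (simp add: nth_eq_iff_index_eq)
  have edge: "E (C ! i) (C ! Suc i)" if "Suc i < n" for i
    using C(1) that unfolding cyc_def n_def by (simp add: successively_nth)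
  have closing: "E (C ! (n - 1)) (C ! 0)"
    using C(1) n unfolding cyc_def n_def by (metis hd_conv_nth last_conv_nth list.size(3) not_numeral_le_zero)
  \<comment> \<open>The closing edge gets colour 2, the value \<open>5 mod 3\<close> it needs when \<open>n = 6\<close>; for \<open>n \<le> 5\<close> its
    colour is irrelevant, as subpaths of the cycle that avoid it already suffice.\<close>
  define c where "c u v = (if \<exists>i. Suc i < n \<and> {u, v} = {C ! i, C ! Suc i}
      then (THE i. Suc i < n \<and> {u, v} = {C ! i, C ! Suc i}) mod 3 else 2)" for u v
  have c_sym: "c u v = c v u" for u v by (simp only: c_def insert_commute[of u v])
  have c_nth: "c (C ! i) (C ! Suc i) = i mod 3" if i: "Suc i < n" for i
  proof -
    have "(THE k. Suc k < n \<and> {C ! i, C ! Suc i} = {C ! k, C ! Suc k}) = i"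
      by (rule the_equality) (use i in \<open>auto simp: doubleton_eq_iff nth_eq\<close>)
    then show ?thesis unfolding c_def using i by auto
  qed
  have c_closing: "c (C ! (n - 1)) (C ! 0) = 2"
    unfolding c_def using n by (auto simp: doubleton_eq_iff nth_eq)
  have "edge_colouring E 3 c"
    unfolding edge_colouring_def using c_sym by (auto simp: c_def)
  moreover have "rainbow_connected V E c"
  proof (rule rainbow_connectedI)
    define R where "R x y \<longleftrightarrow> E x y
      \<or> (\<exists>z. E x z \<and> E z y \<and> distinct [x, z, y] \<and> c x z \<noteq> c z y)
      \<or> (\<exists>z w. E x z \<and> E z w \<and> E w y \<and> distinct [x, z, w, y] \<and> distinct [c x z, c z w, c w y])" for x y
    have R1: "R x y" if "E x y" for x y
      using that unfolding R_def by blast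
    have R2: "R x y" if "E x z" "E z y" "distinct [x, z, y]" "c x z \<noteq> c z y" for x y z
      using that unfolding R_def by blast
    have R3: "R x y" if "E x z" "E z w" "E w y" "distinct [x, z, w, y]" "distinct [c x z, c z w, c w y]"
      for x y z w
      using that unfolding R_def by blast
    have R_sym: "R y x" if xy: "R x y" for x y
    proof -
      consider "E x y" | z where "E x z" "E z y" "distinct [x, z, y]" "c x z \<noteq> c z y"
        | z w where "E x z" "E z w" "E w y" "distinct [x, z, w, y]" "distinct [c x z, c z w, c w y]"
        using xy unfolding R_def by blast
      then show ?thesis
      proof cases
        case 1
        then show ?thesis using R1 sym by blast
      next
        case (2 z)
        then show ?thesis using c_sym[of x z] c_sym[of z y] sym by (intro R2[of y z x]) auto
      next
        case (3 z w)
        then show ?thesis using c_sym[of x z] c_sym[of z w] c_sym[of w y] sym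
          by (intro R3[of y w z x]) auto
      qed
    qed
    have R_less: "R (C ! i) (C ! j)" if ij: "i < j" "j < n" for i j
    proof -
      \<comment> \<open>Since \<open>n\<close> is at most 6, pairs more than three apart are the two
        ends of the list, or 0, 4 and 1, 5 for \<open>n = 6\<close>. The latter two use the closing
        edge of colour 2 with a neighbouring edge of colour 1 or 0.\<close>
      consider "j = Suc i" | "j = Suc (Suc i)" | "j = Suc (Suc (Suc i))" | "i = 0" "j = n - 1"
        | "i = 0" "j = 4" "n = 6" | "i = 1" "j = 5" "n = 6"
        using ij n by linarith
      then show ?thesis
      proof cases
        case 1
        then show ?thesis using R1 edge ij by simp
      next
        case 2
        have "i mod 3 \<noteq> Suc i mod 3" by presburger
        then show ?thesis using 2 edge[of i] edge[of "Suc i"] c_nth[of i] c_nth[of "Suc i"] ij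
          by (intro R2[of _ "C ! Suc i"]) (auto simp: nth_eq)
      next
        case 3
        have "i mod 3 \<noteq> Suc i mod 3" "i mod 3 \<noteq> Suc (Suc i) mod 3" "Suc i mod 3 \<noteq> Suc (Suc i) mod 3"
          by presburger+
        then show ?thesis using 3 edge[of i] edge[of "Suc i"] edge[of "Suc (Suc i)"]
            c_nth[of i] c_nth[of "Suc i"] c_nth[of "Suc (Suc i)"] ij
          by (intro R3[of _ "C ! Suc i" "C ! Suc (Suc i)"]) (auto simp: nth_eq)
      next
        case 4
        then show ?thesis using R1 closing sym by simp
      next
        case 5
        then show ?thesis using edge[of 4] closing c_nth[of 4] c_closing sym
            c_sym[of "C ! 0" "C ! 5"] c_sym[of "C ! 4" "C ! 5"]
          by (intro R2[of _ "C ! 5"]) (auto simp: nth_eq)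
      next
        case 6
        then show ?thesis using edge[of 0] closing c_nth[of 0] c_closing sym
            c_sym[of "C ! 0" "C ! 5"] c_sym[of "C ! 0" "C ! 1"]
          by (intro R2[of _ "C ! 0"]) (auto simp: nth_eq)
      qed
    qed
    fix x y assume "x \<in> V" "y \<in> V" "x \<noteq> y"
    then obtain i j where ij: "i < n" "j < n" "x = C ! i" "y = C ! j" "i \<noteq> j"
      using C(2) unfolding n_def by (metis in_set_conv_nth)
    then have "R x y" using R_less[of i j] R_less[of j i] R_sym by (cases "i < j") auto
    then show "E x y
      \<or> (\<exists>z. E x z \<and> E z y \<and> distinct [x, z, y] \<and> c x z \<noteq> c z y)
      \<or> (\<exists>z w. E x z \<and> E z w \<and> E w y \<and> distinct [x, z, w, y] \<and> distinct [c x z, c z w, c w y])"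
      unfolding R_def .
  qed (use V in auto)
  ultimately show ?thesis by blast
qed

section \<open>Lower bound, distances and the main result\<close>

lemma rc_ge_2:
  assumes ex: "edge_colouring E k c" "rainbow_connected V E c"
    and xy: "x \<in> V" "y \<in> V" "x \<noteq> y" "\<not> E x y"
  shows "2 \<le> rc V E"
proof -
  have "2 \<le> k" if col: "edge_colouring E k c" "rainbow_connected V E c" for k c
  proof -
    obtain vs where vs: "gpath V E vs x y" "distinct (map (\<lambda>(a, b). c a b) (zip vs (tl vs)))"
      using col(2) xy unfolding rainbow_connected_def by blast
    then have w: "vs \<noteq> []" "hd vs = x" "last vs = y" "successively E vs"
      unfolding gpath_def walk_iff_successively by auto
    obtain u v ws where vs': "vs = x # u # v # ws"
    proof (cases vs)
      case (Cons x' us)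
      show ?thesis
      proof (cases us)
        case (Cons u us')
        show ?thesis
          using that w xy \<open>vs = x' # us\<close> Cons by (cases us') auto
      qed (use Cons w xy in auto)
    qed (use w in auto)
    then have "c x u \<noteq> c u v" "E x u" "E u v" using vs(2) w(4) by auto
    moreover from this have "c x u < k" "c u v < k" using col(1) unfolding edge_colouring_def by blast+
    ultimately show ?thesis by linarith
  qed
  \<comment> \<open>The minimum defining \<open>rc\<close> is attained because some rainbow
    colouring exists by \<open>ex\<close>; the bound for arbitrary \<open>k\<close> then applies to
    it.\<close>
  moreover obtain c' where "edge_colouring E (rc V E) c'" "rainbow_connected V E c'"
  proof -
    have "\<exists>k c. edge_colouring E k c \<and> rainbow_connected V E c" using ex by blast
    then have "\<exists>c. edge_colouring E (rc V E) c \<and> rainbow_connected V E c"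
      unfolding rc_def by (rule LeastI_ex)
    then show thesis using that by blast
  qed
  ultimately show ?thesis by blast
qed

text \<open>The walk \<open>ws\<close> ensures that the \<open>LEAST\<close> in \<open>gdist\<close>
  is attained; a shortest walk then has at most three vertices.\<close>

lemma gdist_le_2_cases:
  assumes "walk V E ws x y" "gdist V E x y \<le> 2" "x \<noteq> y"
  shows "E x y \<or> (\<exists>z. E x z \<and> E z y)"
proof -
  have "ws \<noteq> []" using assms(1) unfolding walk_def by blast
  then have "\<exists>n vs. walk V E vs x y \<and> length vs = Suc n"
    using assms(1) by (metis length_Suc_conv list.exhaust)
  then have "\<exists>vs. walk V E vs x y \<and> length vs = Suc (gdist V E x y)"
    unfolding gdist_def by (rule LeastI_ex)
  then obtain vs where vs: "walk V E vs x y" "length vs \<le> 3" using assms(2) by auto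
  then show ?thesis using assms(3) unfolding walk_iff_successively
    by (cases vs; cases "tl vs"; cases "tl (tl vs)") auto
qed

lemma gdist_le_1:
  assumes "E x y" "x \<in> V" "y \<in> V"
  shows "gdist V E x y \<le> 1"
  unfolding gdist_def
  by (rule Least_le, rule exI[of _ "[x, y]"]) (use assms in \<open>auto simp: walk_iff_successively\<close>)

lemma gdist_same:
  assumes "x \<in> V"
  shows "gdist V E x x = 0"
proof -
  have "gdist V E x x \<le> 0" unfolding gdist_def
    by (rule Least_le, rule exI[of _ "[x]"]) (use assms in \<open>auto simp: walk_iff_successively\<close>)
  then show ?thesis by simp
qed

text \<open>The maximum over the finite, nonempty set of distances bounds every distance and is
  attained; a pair attaining 2 is neither equal nor adjacent.\<close>

lemma diameter_2:
  assumes "finite V" "connected_graph V E" "graph_diameter V E = 2"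
  shows "\<And>x y. x \<in> V \<Longrightarrow> y \<in> V \<Longrightarrow> x \<noteq> y \<Longrightarrow> E x y \<or> (\<exists>z. E x z \<and> E z y)"
    and "\<exists>x\<in>V. \<exists>y\<in>V. x \<noteq> y \<and> \<not> E x y"
proof -
  let ?D = "{gdist V E x y | x y. x \<in> V \<and> y \<in> V}"
  have D: "?D = (\<lambda>(x, y). gdist V E x y) ` (V \<times> V)" by auto
  have fin: "finite ?D" unfolding D using assms(1) by simp
  have ne: "?D \<noteq> {}" unfolding D using assms(2) unfolding connected_graph_def by simp
  have M: "Max ?D = 2" using assms(3) unfolding graph_diameter_def .
  show "E x y \<or> (\<exists>z. E x z \<and> E z y)" if xy: "x \<in> V" "y \<in> V" "x \<noteq> y" for x y
  proof -
    have "gdist V E x y \<in> ?D" using xy by blast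
    then have "gdist V E x y \<le> 2" using Max_ge[OF fin] unfolding M by blast
    moreover obtain ws where "walk V E ws x y" using assms(2) xy unfolding connected_graph_def by blast
    ultimately show ?thesis using gdist_le_2_cases xy by metis
  qed
  have "2 \<in> ?D" using Max_in[OF fin ne] unfolding M .
  then obtain x y where xy: "x \<in> V" "y \<in> V" "2 = gdist V E x y"
    unfolding mem_Collect_eq by (elim exE conjE)
  have "x \<noteq> y" using gdist_same[of x V E] xy by auto
  moreover have "\<not> E x y" using gdist_le_1[of E x y V] xy by auto
  ultimately show "\<exists>x\<in>V. \<exists>y\<in>V. x \<noteq> y \<and> \<not> E x y" using xy by blast
qed

theorem theorem2:
  fixes V :: "'a set" and E :: "'a \<Rightarrow> 'a \<Rightarrow> bool" and n :: nat
  assumes "simple_graph V E"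
    and "card V = n"
    and "outerplanar V E"
    and "bridgeless V E"
    and "connected_graph V E"
    and "graph_diameter V E = 2"
  shows "rc V E \<le> 3 \<and> rc V E \<in> {2, 3}"
proof -
  note simple = assms(1)
  have fin: "finite V" and V: "\<And>u v. E u v \<Longrightarrow> u \<in> V \<and> v \<in> V" and sym: "\<And>u v. E u v \<Longrightarrow> E v u"
    using simple unfolding simple_graph_def by blast+
  note diam = diameter_2[OF fin assms(5,6)]
  have deg: "\<exists>w. E u w \<and> w \<noteq> v" if "E u v" for u v
    using bridgeless_other_neighbour[OF simple assms(4) that] by blast
  have "\<exists>c. edge_colouring E 3 c \<and> rainbow_connected V E c"
  proof (cases "\<exists>v\<in>V. \<forall>x\<in>V. x \<noteq> v \<longrightarrow> E v x")
    case True
    then obtain v where v: "v \<in> V" "\<And>x. x \<in> V \<Longrightarrow> x \<noteq> v \<Longrightarrow> E v x" by blast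
    show ?thesis
      by (rule rc_universal_vertex[OF simple v]) (use v deg sym in blast)+
  next
    case False
    note theta_free = outerplanar_theta_free[OF simple assms(3)]
    have no_universal: "\<exists>x\<in>V. x \<noteq> v \<and> \<not> E v x" if "v \<in> V" for v using False that by blast
    have "V \<noteq> {}" using assms(5) unfolding connected_graph_def by blast
    then obtain C where C: "cyc E C" "set C = V"
      using Hamiltonian_cycle_exists[OF simple theta_free diam(1) no_universal deg] by blast
    have "length C \<le> 6"
      by (rule Hamiltonian_cycle_length[OF simple theta_free diam(1) no_universal C])
    then show ?thesis by (rule rainbow_connected_Hamiltonian_cycle[OF simple C])
  qed
  then obtain c where c: "edge_colouring E 3 c" "rainbow_connected V E c" by blast
  obtain x y where "x \<in> V" "y \<in> V" "x \<noteq> y" "\<not> E x y" using diam(2) by blast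
  then have "2 \<le> rc V E" using rc_ge_2[OF c] by blast
  moreover have "rc V E \<le> 3" using rc_le[OF c] .
  ultimately show ?thesis by auto
qed

end
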